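(* For any $0\le\epsilon<1$, the function $l_\epsilon:\mathbb{Z}\to\mathbb{R}_{\ge0}$ defined by $l_\epsilon(n)=|n|+\epsilon^{|n|}$ for $n\ne0$ and $l_\epsilon(0)=0$ is a hyperbolic length function. For $\epsilon=1/2$, the function $l_{1/2}$ is not equal to any based length function $l_p$ arising from a co-compact, isometric action of $\mathbb{Z}$ on a metric graph (with $p$ any point of the graph).
   Context: A length function on a group $G$ is a map $l: G \to \mathbb{R}_{\geq 0}$ such that: (A1) $l(g)=0$ if and only if $g=1$; (A2) $l(g^{-1})=l(g)$; (A3) $c(g,h)\ge 0$ for all $g,h\in G$, where $c(g,h) := \frac{1}{2}(l(g)+l(h)-l(gh^{-1}))$. (For $G=\mathbb{Z}$ the identity is $0$ and $gh^{-1}$ means $g-h$.) It is $\delta$-hyperbolic ($\delta\ge0$) if for all $g_1,g_2,g_3\in G$ and all real $m$: $c(g_1,g_2)\ge m$ and $c(g_2,g_3)\ge m$ imply $c(g_1,g_3)\ge m-\delta$; it is hyperbolic if it is $\delta$-hyperbolic for some $\delta\ge0$. A metric graph is a (connected) 1-dimensional CW-complex with a metric structure (each edge has a positive real length), equipped with the path metric. Actions on metric graphs are isometric right actions sending vertices to vertices and edges to edges; co-compact means the quotient is compact (in particular there are finitely many orbits of edges). The based length function at a point $p$ of the graph $\Gamma$ is $l_p(g)=d_\Gamma(p,pg)$. *)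

theory Defs
  imports "HOL-Analysis.Analysis"
begin

section \<open>Length functions\<close>

text \<open>
  Groups are written additively (class \<^class>\<open>group_add\<close>, which does not assume
  commutativity), so \<open>g h\<inverse>\<close> becomes \<open>g - h\<close>.
\<close>

definition gromov_c :: "('g::group_add \<Rightarrow> real) \<Rightarrow> 'g \<Rightarrow> 'g \<Rightarrow> real" where
  "gromov_c l g h = (l g + l h - l (g - h)) / 2"

definition length_function :: "('g::group_add \<Rightarrow> real) \<Rightarrow> bool" where
  "length_function l \<longleftrightarrow>
     (\<forall>g. l g \<ge> 0) \<and>
     (\<forall>g. l g = 0 \<longleftrightarrow> g = 0) \<and>
     (\<forall>g. l (- g) = l g) \<and>
     (\<forall>g h. gromov_c l g h \<ge> 0)"

definition delta_hyperbolic :: "real \<Rightarrow> ('g::group_add \<Rightarrow> real) \<Rightarrow> bool" where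
  "delta_hyperbolic \<delta> l \<longleftrightarrow>
     (\<forall>g1 g2 g3 m. gromov_c l g1 g2 \<ge> m \<and> gromov_c l g2 g3 \<ge> m \<longrightarrow> gromov_c l g1 g3 \<ge> m - \<delta>)"

definition hyperbolic :: "('g::group_add \<Rightarrow> real) \<Rightarrow> bool" where
  "hyperbolic l \<longleftrightarrow> (\<exists>\<delta>\<ge>0. delta_hyperbolic \<delta> l)"

definition l_eps :: "real \<Rightarrow> int \<Rightarrow> real" where
  "l_eps \<epsilon> n = (if n = 0 then 0 else \<bar>real_of_int n\<bar> + \<epsilon> ^ nat \<bar>n\<bar>)"


section \<open>Metric graphs\<close>

text \<open>
  A connected one-dimensional CW complex \<open>X\<close> with vertex set \<open>V\<close> and edges indexed by \<open>E\<close>.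
  The edge \<open>e\<close> has length \<open>len e\<close> and characteristic map \<open>chi e\<close>, of which only the
  restriction to the interval \<open>{0..len e}\<close> is relevant.  Loops, multiple edges and vertices of
  infinite valence are allowed.  The axiom \<open>weak_topology\<close> says that \<open>X\<close> carries the CW (weak)
  topology, which in the absence of local finiteness is finer than that of the path metric.
\<close>

locale metric_graph =
  fixes X :: "'a topology"
    and V :: "'a set"
    and E :: "'e set"
    and len :: "'e \<Rightarrow> real"
    and chi :: "'e \<Rightarrow> real \<Rightarrow> 'a"
  assumes len_pos: "e \<in> E \<Longrightarrow> len e > 0"
    and chi_endpoints: "e \<in> E \<Longrightarrow> chi e 0 \<in> V \<and> chi e (len e) \<in> V"
    and chi_inj: "e \<in> E \<Longrightarrow> inj_on (chi e) {0<..<len e}"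
    and cells_cover: "topspace X = V \<union> (\<Union>e\<in>E. chi e ` {0<..<len e})"
    and cells_disjoint: "disjoint_family_on (\<lambda>e. chi e ` {0<..<len e}) E"
    and vertices_disjoint: "e \<in> E \<Longrightarrow> V \<inter> chi e ` {0<..<len e} = {}"
    and weak_topology: "U \<subseteq> topspace X \<Longrightarrow>
          openin X U \<longleftrightarrow>
          (\<forall>e\<in>E. openin (top_of_set {0..len e}) {s \<in> {0..len e}. chi e s \<in> U})"
    and connected: "connected_space X"
begin

definition edge :: "'e \<Rightarrow> 'a set" where
  "edge e = chi e ` {0..len e}"

text \<open>
  A piecewise linear path is a list of triples \<open>(e, s, t)\<close>, each standing for the segment of
  the edge \<open>e\<close> traversed linearly from parameter \<open>s\<close> to parameter \<open>t\<close> (in either direction).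
\<close>

primrec pl_path :: "'a \<Rightarrow> ('e \<times> real \<times> real) list \<Rightarrow> 'a \<Rightarrow> bool" where
  "pl_path x [] y \<longleftrightarrow> x = y"
| "pl_path x (seg # w) y \<longleftrightarrow>
     (case seg of (e, s, t) \<Rightarrow>
        e \<in> E \<and> s \<in> {0..len e} \<and> t \<in> {0..len e} \<and> x = chi e s \<and> pl_path (chi e t) w y)"

definition pl_length :: "('e \<times> real \<times> real) list \<Rightarrow> real" where
  "pl_length w = (\<Sum>(e, s, t)\<leftarrow>w. \<bar>s - t\<bar>)"

text \<open>
  In general this is only a pseudometric, since infinitely many edges may have lengths tending
  to zero.  It is a metric whenever the edge lengths are bounded below, in particular if there
  are only finitely many of them, as is the case for a co-compact action.
\<close>

definition path_dist :: "'a \<Rightarrow> 'a \<Rightarrow> real" where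
  "path_dist x y = Inf {pl_length w | w. pl_path x w y}"

end


section \<open>Actions on metric graphs\<close>

locale metric_graph_action = metric_graph X V E len chi
  for X :: "'a topology" and V :: "'a set" and E :: "'e set"
    and len :: "'e \<Rightarrow> real" and chi :: "'e \<Rightarrow> real \<Rightarrow> 'a" +
  fixes act :: "'a \<Rightarrow> 'g::group_add \<Rightarrow> 'a"
  assumes act_closed: "x \<in> topspace X \<Longrightarrow> act x g \<in> topspace X"
    and act_zero: "x \<in> topspace X \<Longrightarrow> act x 0 = x"
    and act_add: "x \<in> topspace X \<Longrightarrow> act (act x g) h = act x (g + h)"
    and act_isometric: "x \<in> topspace X \<Longrightarrow> y \<in> topspace X \<Longrightarrow>
          path_dist (act x g) (act y g) = path_dist x y"
    and act_vertex: "x \<in> V \<Longrightarrow> act x g \<in> V"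
    and act_edge: "e \<in> E \<Longrightarrow> \<exists>e'\<in>E. (\<lambda>x. act x g) ` edge e = edge e'"
begin

definition orbit :: "'a \<Rightarrow> 'a set" where
  "orbit x = range (act x)"

text \<open>
  The topology \<open>Q\<close> is uniquely determined: it is the quotient of the CW topology of \<open>X\<close> on the
  set of orbits.
\<close>

definition cocompact :: bool where
  "cocompact \<longleftrightarrow> (\<exists>Q. quotient_map X Q orbit \<and> compact_space Q)"

definition based_length :: "'a \<Rightarrow> 'g \<Rightarrow> real" where
  "based_length p g = path_dist p (act p g)"

end

end

theory Submission
  imports Defs
begin

text \<open>
  The function \<open>l_eps \<epsilon>\<close> differs from the tree-like length function \<open>\<bar>n\<bar>\<close> by a bounded amount, and
  hyperbolicity survives bounded perturbations.  The triangle inequality survives as well,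
  because \<open>\<bar>n\<bar>\<close> takes integer values: where it is strict for \<open>\<bar>n\<bar>\<close>, the slack is at least \<open>1\<close> and
  absorbs the perturbation.

  The obstruction to realising \<open>l_eps (1/2)\<close> geometrically is arithmetic.  A cocompact action has
  only finitely many edge lengths.  A shortest path from \<open>p\<close> to a translate of \<open>p\<close> consists of
  whole edges except for an initial and a final piece, and up to finitely many choices these two
  pieces do not depend on the translate.  Hence all values of the based length function lie in a
  finitely generated monoid of reals (\<open>based_length_in_finitely_generated\<close>).  The rational numbers
  in such a monoid have a common denominator (\<open>rationals_in_sums_of_common_denominator\<close>), whereas
  the numbers \<open>n + 1 / 2 ^ n\<close> do not.

  That there are only finitely many edge lengths requires an invariant description of the length
  of an edge, since the action is only known to permute edges as point sets and to preserve the
  path metric, in which an edge need not be a geodesic.  The distance to the vertex set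
  (\<open>depth\<close>) serves this purpose: it is invariant, and on an edge it is just the distance, measured
  along the edge, to the nearer end.  So lengths and midpoints of edges are preserved, and an open
  cover of the quotient built from midpoints gives the finiteness (\<open>finite_edge_lengths\<close>).
\<close>

section \<open>Length functions close to the absolute value\<close>

lemma length_function_l_eps:
  assumes "0 \<le> \<epsilon>" "\<epsilon> < 1"
  shows "length_function (l_eps \<epsilon>)"
proof -
  have le1: "\<epsilon> ^ k \<le> 1" for k
    using assms by (simp add: power_le_one)
  have nonneg: "l_eps \<epsilon> g \<ge> 0" for g
    using assms by (simp add: l_eps_def)
  have zero: "l_eps \<epsilon> g = 0 \<longleftrightarrow> g = 0" for g
  proof -
    have "g \<noteq> 0 \<Longrightarrow> \<bar>real_of_int g\<bar> + \<epsilon> ^ nat \<bar>g\<bar> > 0"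
      using assms by (intro add_pos_nonneg) auto
    then show ?thesis by (auto simp: l_eps_def)
  qed
  have triangle: "l_eps \<epsilon> (g - h) \<le> l_eps \<epsilon> g + l_eps \<epsilon> h" for g h
  proof (cases "g = 0 \<or> h = 0 \<or> g = h")
    case True
    then show ?thesis using nonneg[of g] by (auto simp: l_eps_def)
  next
    case False
    then have eqs: "l_eps \<epsilon> (g - h) = \<bar>real_of_int (g - h)\<bar> + \<epsilon> ^ nat \<bar>g - h\<bar>"
      "l_eps \<epsilon> g = \<bar>real_of_int g\<bar> + \<epsilon> ^ nat \<bar>g\<bar>"
      "l_eps \<epsilon> h = \<bar>real_of_int h\<bar> + \<epsilon> ^ nat \<bar>h\<bar>"
      by (auto simp: l_eps_def)
    have pos: "\<epsilon> ^ nat \<bar>g\<bar> \<ge> 0" "\<epsilon> ^ nat \<bar>h\<bar> \<ge> 0" using assms by auto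
    \<comment> \<open>Either the exponents add up, and the power on the left is dominated by one on the right,
      or the absolute values leave a slack of at least \<open>1\<close>.\<close>
    show ?thesis
    proof (cases "\<bar>g - h\<bar> = \<bar>g\<bar> + \<bar>h\<bar>")
      case True
      then have "\<epsilon> ^ nat \<bar>g - h\<bar> \<le> \<epsilon> ^ nat \<bar>g\<bar>"
        using assms by (intro power_decreasing) auto
      then show ?thesis using eqs pos by linarith
    next
      case False
      then have "\<bar>g - h\<bar> + 1 \<le> \<bar>g\<bar> + \<bar>h\<bar>" by linarith
      then have "\<bar>real_of_int (g - h)\<bar> + 1 \<le> \<bar>real_of_int g\<bar> + \<bar>real_of_int h\<bar>"
        by linarith
      then show ?thesis using eqs pos le1[of "nat \<bar>g - h\<bar>"] by linarith
    qed
  qed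
  have sym: "l_eps \<epsilon> (- g) = l_eps \<epsilon> g" for g
    by (simp add: l_eps_def)
  show ?thesis
    unfolding length_function_def gromov_c_def using nonneg zero sym triangle by simp
qed

text \<open>
  For \<open>\<bar>n\<bar>\<close> itself, the value \<open>c(g, h)\<close> is \<open>min \<bar>g\<bar> \<bar>h\<bar>\<close> when \<open>g\<close> and \<open>h\<close> have the same sign and
  \<open>0\<close> otherwise, so it is \<open>0\<close>-hyperbolic.  A perturbation by values in \<open>[0, 1]\<close> moves each
  \<open>c\<close> by at most \<open>1\<close>.
\<close>

lemma hyperbolic_l_eps:
  assumes "0 \<le> \<epsilon>" "\<epsilon> < 1"
  shows "hyperbolic (l_eps \<epsilon>)"
proof -
  have near: "\<bar>real_of_int g\<bar> \<le> l_eps \<epsilon> g" "l_eps \<epsilon> g \<le> \<bar>real_of_int g\<bar> + 1" for g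
    using assms by (auto simp: l_eps_def power_le_one)
  define c where "c g h = (\<bar>real_of_int g\<bar> + \<bar>real_of_int h\<bar> - \<bar>real_of_int (g - h)\<bar>) / 2" for g h
  have c_near: "\<bar>gromov_c (l_eps \<epsilon>) g h - c g h\<bar> \<le> 1" for g h
  proof -
    have "\<bar>(a' + b' - d') / 2 - (a + b - d) / 2\<bar> \<le> 1"
      if "a \<le> a'" "a' \<le> a + 1" "b \<le> b'" "b' \<le> b + 1" "d \<le> d'" "d' \<le> d + 1"
      for a b d a' b' d' :: real
      using that by (simp add: abs_le_iff field_simps)
    then show ?thesis unfolding gromov_c_def c_def using near by blast
  qed
  have c_hyp: "min (c g1 g2) (c g2 g3) \<le> c g1 g3" for g1 g2 g3
    unfolding c_def of_int_diff min_le_iff_disj by argo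
  have "delta_hyperbolic 2 (l_eps \<epsilon>)"
    unfolding delta_hyperbolic_def
  proof (intro allI impI)
    fix g1 g2 g3 m
    assume "m \<le> gromov_c (l_eps \<epsilon>) g1 g2 \<and> m \<le> gromov_c (l_eps \<epsilon>) g2 g3"
    then show "m - 2 \<le> gromov_c (l_eps \<epsilon>) g1 g3"
      using c_near[of g1 g2] c_near[of g2 g3] c_near[of g1 g3] c_hyp[of g1 g2 g3] by linarith
  qed
  then show ?thesis unfolding hyperbolic_def by (intro exI[of _ 2]) simp
qed

section \<open>Finitely generated monoids of reals\<close>

definition sums_of :: "real set \<Rightarrow> real set" where
  "sums_of A = sum_list ` lists A"

lemma sums_of_0: "0 \<in> sums_of A"
  unfolding sums_of_def by (rule image_eqI[of _ _ "[]"]) auto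

lemma sums_of_single: "a \<in> A \<Longrightarrow> a \<in> sums_of A"
  unfolding sums_of_def by (rule image_eqI[of _ _ "[a]"]) auto

lemma sums_of_add:
  assumes "x \<in> sums_of A" "y \<in> sums_of A" shows "x + y \<in> sums_of A"
proof -
  obtain xs ys where "x = sum_list xs" "xs \<in> lists A" "y = sum_list ys" "ys \<in> lists A"
    using assms unfolding sums_of_def by blast
  then show ?thesis
    unfolding sums_of_def by (intro image_eqI[of _ _ "xs @ ys"]) auto
qed

lemma sums_of_mono: "A \<subseteq> B \<Longrightarrow> sums_of A \<subseteq> sums_of B"
  unfolding sums_of_def by (intro image_mono lists_mono)

text \<open>
  A sum bounded by \<open>C\<close> has at most \<open>C / \<mu>\<close> nonzero terms, where \<open>\<mu>\<close> is the least positive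
  generator.
\<close>

lemma finite_sums_of_bounded:
  assumes fin: "finite A" and nonneg: "\<And>a. a \<in> A \<Longrightarrow> a \<ge> 0"
  shows "finite (sums_of A \<inter> {..C})"
proof -
  define P where "P = {a \<in> A. a > 0}"
  obtain \<mu> where \<mu>: "\<mu> > 0" "\<And>a. a \<in> P \<Longrightarrow> \<mu> \<le> a"
  proof (cases "P = {}")
    case True then show ?thesis using that[of 1] by simp
  next
    case False
    have "finite P" using fin by (simp add: P_def)
    then show ?thesis using False that[of "Min P"] Min_in[of P] by (simp add: P_def)
  qed
  define k where "k = nat \<lceil>C / \<mu>\<rceil>"
  have "sums_of A \<inter> {..C} \<subseteq> sum_list ` {xs. set xs \<subseteq> P \<and> length xs \<le> k}"
  proof
    fix x assume "x \<in> sums_of A \<inter> {..C}"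
    then obtain xs where xs: "x = sum_list xs" "set xs \<subseteq> A" "sum_list xs \<le> C"
      unfolding sums_of_def by auto
    define ys where "ys = filter (\<lambda>a. a > 0) xs"
    have "set xs \<subseteq> A \<Longrightarrow> sum_list (filter (\<lambda>a. a > 0) xs) = sum_list xs" for xs
      by (induction xs) (use nonneg in \<open>auto simp: not_less intro: antisym\<close>)
    then have sum: "sum_list ys = x" using xs by (simp add: ys_def)
    have sub: "set ys \<subseteq> P" using xs by (auto simp: ys_def P_def)
    have "set ys \<subseteq> P \<Longrightarrow> \<mu> * length ys \<le> sum_list ys" for ys
      by (induction ys) (auto simp: algebra_simps intro: add_mono \<mu>)
    then have "\<mu> * length ys \<le> C" using sub sum xs by fastforce
    then have "length ys \<le> C / \<mu>" using \<mu>(1) by (simp add: field_simps)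
    then have "length ys \<le> k" unfolding k_def by linarith
    then show "x \<in> sum_list ` {xs. set xs \<subseteq> P \<and> length xs \<le> k}"
      using sub sum by blast
  qed
  moreover have "finite {xs. set xs \<subseteq> P \<and> length xs \<le> k}"
    using fin by (intro finite_lists_length_le) (simp add: P_def)
  ultimately show ?thesis using finite_surj by blast
qed

text \<open>
  Used with \<open>T\<close> the set of lengths of all paths between two points and \<open>S\<close> a monoid of lengths:
  once every path can be shortened to one with length in \<open>S\<close>, the infimum is attained there.
\<close>

lemma Inf_in_locally_finite:
  fixes T S :: "real set"
  assumes fin: "\<And>C. finite (S \<inter> {..C})" and ne: "T \<noteq> {}"
    and below: "\<And>t. t \<in> T \<Longrightarrow> \<exists>r\<in>S \<inter> T. r \<le> t"
  shows "Inf T \<in> S"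
proof -
  obtain r0 where r0: "r0 \<in> S" "r0 \<in> T" using ne below by blast
  define F where "F = S \<inter> T \<inter> {..r0}"
  have F: "finite F" "F \<noteq> {}"
    using fin[of r0] r0 by (auto simp: F_def intro: finite_subset[of _ "S \<inter> {..r0}"])
  have "Min F \<in> F" using F by simp
  moreover have "Min F \<le> t" if t: "t \<in> T" for t
  proof -
    obtain r where r: "r \<in> S \<inter> T" "r \<le> t" using below[OF t] by blast
    show ?thesis
    proof (cases "r \<le> r0")
      case True then have "r \<in> F" using r by (simp add: F_def)
      then show ?thesis using F r by (meson Min_le order_trans)
    next
      case False
      have "r0 \<in> F" using r0 by (simp add: F_def)
      then have "Min F \<le> r0" using F by simp
      then show ?thesis using False r by linarith
    qed
  qed
  ultimately have "Inf T = Min F"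
    by (intro cInf_eq_minimum) (auto simp: F_def)
  then show ?thesis using \<open>Min F \<in> F\<close> by (simp add: F_def)
qed

text \<open>
  Extend \<open>1 \<mapsto> 1\<close> to a \<open>\<rat>\<close>-linear functional \<open>\<phi>\<close> from the reals to the rationals.  It fixes every
  rational, and a common denominator of its finitely many values on the generators is a common
  denominator of its values on all sums.
\<close>

lemma rationals_in_sums_of_common_denominator:
  assumes "finite B"
  shows "\<exists>N::int. N > 0 \<and> (\<forall>q. of_rat q \<in> sums_of B \<longrightarrow> of_int N * q \<in> \<int>)"
proof -
  interpret Q: vector_space_pair "\<lambda>q x. of_rat q * (x::real)" "(*) :: rat \<Rightarrow> rat \<Rightarrow> rat"
    by unfold_locales (auto simp: algebra_simps of_rat_add of_rat_mult)
  have "Q.vs1.independent {1}" by simp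
  then obtain \<phi> :: "real \<Rightarrow> rat"
    where lin: "Vector_Spaces.linear (\<lambda>q x. of_rat q * x) (*) \<phi>" and "\<phi> 1 = 1"
    using Q.linear_independent_extend[of "{1}" "\<lambda>_. 1"] by auto
  interpret L: Vector_Spaces.linear "\<lambda>q x. of_rat q * (x::real)" "(*) :: rat \<Rightarrow> rat \<Rightarrow> rat" \<phi>
    by (rule lin)
  have rat: "\<phi> (of_rat q) = q" for q
    using L.scale[of q 1] \<open>\<phi> 1 = 1\<close> by simp
  have "\<exists>N::int. N > 0 \<and> (\<forall>b\<in>B. of_int N * \<phi> b \<in> \<int>)"
    using assms
  proof (induction B)
    case empty
    show ?case by (rule exI[of _ 1]) simp
  next
    case (insert b B)
    then obtain N where N: "N > 0" "\<forall>b\<in>B. of_int N * \<phi> b \<in> \<int>" by auto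
    obtain a d where ad: "\<phi> b = Fract a d" "d > 0" by (cases "\<phi> b") auto
    then have db: "of_int d * \<phi> b = of_int a" by (simp add: Fract_of_int_quotient)
    have "of_int (N * d) * \<phi> b \<in> \<int>"
      using Ints_of_int[of "N * a"] db by (simp add: mult.assoc)
    moreover have "of_int (N * d) * \<phi> c \<in> \<int>" if "c \<in> B" for c
      using Ints_mult[of "of_int d" "of_int N * \<phi> c"] N that by (simp add: ac_simps)
    ultimately show ?case using N ad by (intro exI[of _ "N * d"]) auto
  qed
  then obtain N where N: "N > 0" "\<forall>b\<in>B. of_int N * \<phi> b \<in> \<int>" by auto
  have "xs \<in> lists B \<Longrightarrow> of_int N * \<phi> (sum_list xs) \<in> \<int>" for xs
    by (induction xs) (use N in \<open>auto simp: L.zero L.add ring_distribs\<close>)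
  then have "of_int N * \<phi> x \<in> \<int>" if "x \<in> sums_of B" for x
    using that unfolding sums_of_def by auto
  then show ?thesis using N(1) rat by metis
qed

section \<open>Paths in metric graphs\<close>

context metric_graph
begin

lemma chi_in_topspace:
  assumes "e \<in> E" "s \<in> {0..len e}" shows "chi e s \<in> topspace X"
proof (cases "s \<in> {0<..<len e}")
  case True then show ?thesis using assms cells_cover by blast
next
  case False
  then have "s = 0 \<or> s = len e" using assms by auto
  then show ?thesis using assms cells_cover chi_endpoints by auto
qed

lemma chi_in_V_iff:
  assumes "e \<in> E" "s \<in> {0..len e}"
  shows "chi e s \<in> V \<longleftrightarrow> s \<in> {0, len e}"
proof
  assume "chi e s \<in> V"
  then have "s \<notin> {0<..<len e}" using vertices_disjoint[OF assms(1)] by blast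
  then show "s \<in> {0, len e}" using assms by auto
qed (use assms chi_endpoints in auto)

lemma chi_eq_cases:
  assumes e: "e \<in> E" "s \<in> {0..len e}" and f: "f \<in> E" "t \<in> {0..len f}"
    and eq: "chi e s = chi f t"
  obtains "e = f" "s = t" | "s \<in> {0, len e}" "t \<in> {0, len f}"
proof (cases "chi e s \<in> V")
  case True
  then show ?thesis using that(2) chi_in_V_iff e f eq by metis
next
  case False
  then have int: "s \<in> {0<..<len e}" "t \<in> {0<..<len f}"
    using chi_in_V_iff[OF e] chi_in_V_iff[OF f] eq e f by auto
  have "e = f"
  proof (rule ccontr)
    assume "e \<noteq> f"
    then have "chi e ` {0<..<len e} \<inter> chi f ` {0<..<len f} = {}"
      using cells_disjoint e f unfolding disjoint_family_on_def by blast
    then show False using int eq by (metis IntI empty_iff imageI)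
  qed
  then have "s = t" using int eq chi_inj[OF e(1)] by (auto dest: inj_onD)
  then show ?thesis using that(1) \<open>e = f\<close> by blast
qed

lemma pl_path_append: "pl_path x (u @ w) z \<longleftrightarrow> (\<exists>y. pl_path x u y \<and> pl_path y w z)"
  by (induction u arbitrary: x) auto

lemma pl_length_simps [simp]:
  "pl_length [] = 0" "pl_length ((e, s, t) # w) = \<bar>s - t\<bar> + pl_length w"
  "pl_length (u @ w) = pl_length u + pl_length w"
  by (simp_all add: pl_length_def)

lemma pl_length_nonneg: "pl_length w \<ge> 0"
  unfolding pl_length_def by (intro sum_list_nonneg) auto

text \<open>
  The set of points reachable from \<open>x\<close> contains each edge entirely or avoids it, so it is open
  and closed in the weak topology.
\<close>

lemma pl_path_exists:
  assumes x: "x \<in> topspace X" and y: "y \<in> topspace X"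
  shows "\<exists>w. pl_path x w y"
proof -
  define R where "R = {z \<in> topspace X. \<exists>w. pl_path x w z}"
  have whole: "chi e t \<in> R" if whole: "e \<in> E" "s \<in> {0..len e}" "t \<in> {0..len e}" "chi e s \<in> R" for e s t
  proof -
    obtain w where "pl_path x w (chi e s)" using whole by (auto simp: R_def)
    then have "pl_path x (w @ [(e, s, t)]) (chi e t)" using that by (auto simp: pl_path_append)
    then show ?thesis using that chi_in_topspace by (auto simp: R_def)
  qed
  have whole_open: "openin (top_of_set A) Y" if "Y \<in> {{}, A}" for A Y :: "real set"
    using that by auto
  have "openin X R"
  proof (subst weak_topology)
    show "\<forall>e\<in>E. openin (top_of_set {0..len e}) {s \<in> {0..len e}. chi e s \<in> R}"
    proof
      fix e assume "e \<in> E"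
      then have "{s \<in> {0..len e}. chi e s \<in> R} \<in> {{}, {0..len e}}" using whole by blast
      then show "openin (top_of_set {0..len e}) {s \<in> {0..len e}. chi e s \<in> R}"
        by (rule whole_open)
    qed
  qed (auto simp: R_def)
  moreover have "openin X (topspace X - R)"
  proof (subst weak_topology)
    show "\<forall>e\<in>E. openin (top_of_set {0..len e}) {s \<in> {0..len e}. chi e s \<in> topspace X - R}"
    proof
      fix e assume "e \<in> E"
      then have "{s \<in> {0..len e}. chi e s \<in> topspace X - R} \<in> {{}, {0..len e}}"
        using whole chi_in_topspace by blast
      then show "openin (top_of_set {0..len e}) {s \<in> {0..len e}. chi e s \<in> topspace X - R}"
        by (rule whole_open)
    qed
  qed auto
  moreover have "R \<subseteq> topspace X" by (auto simp: R_def)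
  ultimately have "R = {} \<or> R = topspace X"
    using connected unfolding connected_space_clopen_in closedin_def by blast
  moreover have "x \<in> R" using x by (auto simp: R_def intro: exI[of _ "[]"])
  ultimately show ?thesis using y by (auto simp: R_def)
qed

lemma path_dist_le: "pl_path x w y \<Longrightarrow> path_dist x y \<le> pl_length w"
  unfolding path_dist_def
  by (rule cInf_lower) (auto intro!: bdd_belowI[of _ 0] pl_length_nonneg)

lemma path_dist_greatest:
  assumes "x \<in> topspace X" "y \<in> topspace X" "\<And>w. pl_path x w y \<Longrightarrow> r \<le> pl_length w"
  shows "r \<le> path_dist x y"
  unfolding path_dist_def
  by (rule cInf_greatest) (use assms pl_path_exists in auto)

text \<open>
  A path stays in its first edge until it reaches an end \<open>c\<close> of that edge, which costs at least
  \<open>\<bar>s - c\<bar>\<close>.  Each later passage from a vertex to a vertex within one edge either crosses the edge,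
  and can be replaced by one full traversal, or returns to its start, and can be dropped.
\<close>

lemma pl_path_to_vertex_shorten:
  assumes "pl_path x w v" "v \<in> V" "e \<in> E" "s \<in> {0..len e}" "x = chi e s"
  shows "\<exists>c w'. c \<in> {0, len e} \<and> pl_path (chi e c) w' v \<and> pl_length w' \<in> sums_of (len ` E) \<and>
           \<bar>s - c\<bar> + pl_length w' \<le> pl_length w"
  using assms
proof (induction w arbitrary: x e s)
  case Nil
  then have "s \<in> {0, len e}" using chi_in_V_iff by auto
  then show ?case using Nil by (intro exI[of _ s] exI[of _ "[]"]) (auto simp: sums_of_0)
next
  case (Cons seg w)
  obtain e1 s1 t1 where seg: "seg = (e1, s1, t1)" by (cases seg)
  have 1: "e1 \<in> E" "s1 \<in> {0..len e1}" "t1 \<in> {0..len e1}" "x = chi e1 s1"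
    and w: "pl_path (chi e1 t1) w v"
    using Cons.prems(1) by (auto simp: seg)
  obtain c1 w1 where c1: "c1 \<in> {0, len e1}" "pl_path (chi e1 c1) w1 v"
    "pl_length w1 \<in> sums_of (len ` E)" and le: "\<bar>t1 - c1\<bar> + pl_length w1 \<le> pl_length w"
    using Cons.IH[OF w Cons.prems(2) 1(1) 1(3) refl] by blast
  from le have le': "\<bar>s1 - c1\<bar> + pl_length w1 \<le> pl_length (seg # w)" by (simp add: seg)
  have "chi e s = chi e1 s1" using 1 Cons.prems by simp
  from chi_eq_cases[OF Cons.prems(3,4) 1(1,2) this] show ?case
  proof cases
    case 1
    then show ?thesis using c1 le' by blast
  next
    case 2
    show ?thesis
    proof (cases "s1 = c1")
      case True
      then show ?thesis
        using 2 c1 le' 1 Cons.prems by (intro exI[of _ s] exI[of _ w1]) auto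
    next
      case False
      have "0 < len e1" using len_pos 1(1) .
      then have full: "\<bar>s1 - c1\<bar> = len e1" using 2 c1 False by auto
      have "pl_path (chi e s) ((e1, s1, c1) # w1) v"
        using 1 c1 Cons.prems \<open>0 < len e1\<close> by auto
      moreover have "pl_length ((e1, s1, c1) # w1) \<in> sums_of (len ` E)"
        using full c1 1 by (auto intro: sums_of_add sums_of_single)
      moreover have "\<bar>s - s\<bar> + pl_length ((e1, s1, c1) # w1) \<le> pl_length (seg # w)"
        using le' by simp
      ultimately show ?thesis using 2 by blast
    qed
  qed
qed

text \<open>
  The part of a path after it has last entered the edge of its end point: either the whole path
  stays in that edge, or it enters through an end \<open>c\<close>, from which it still needs \<open>\<bar>c - t\<bar>\<close>.
\<close>

lemma pl_path_last_edge:
  assumes "pl_path x w (chi f t)" "f \<in> E" "t \<in> {0..len f}"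
  shows "(\<exists>s\<in>{0..len f}. x = chi f s \<and> \<bar>s - t\<bar> \<le> pl_length w) \<or>
         (\<exists>c w'. c \<in> {0, len f} \<and> pl_path x w' (chi f c) \<and> pl_length w' + \<bar>c - t\<bar> \<le> pl_length w)"
  using assms
proof (induction w arbitrary: x)
  case Nil
  then show ?case by auto
next
  case (Cons seg w)
  obtain e1 s1 t1 where seg: "seg = (e1, s1, t1)" by (cases seg)
  have 1: "e1 \<in> E" "s1 \<in> {0..len e1}" "t1 \<in> {0..len e1}" "x = chi e1 s1"
    and w: "pl_path (chi e1 t1) w (chi f t)"
    using Cons.prems(1) by (auto simp: seg)
  have enter: ?case if "c \<in> {0, len f}" "pl_path (chi e1 t1) w' (chi f c)"
    "pl_length w' + \<bar>c - t\<bar> \<le> pl_length w" for c w'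
  proof -
    have "pl_path x ((e1, s1, t1) # w') (chi f c)" using 1 that by auto
    moreover have "pl_length ((e1, s1, t1) # w') + \<bar>c - t\<bar> \<le> pl_length (seg # w)"
      using that by (simp add: seg)
    ultimately show ?thesis using that(1) by blast
  qed
  from Cons.IH[OF w Cons.prems(2,3)] show ?case
  proof (elim disjE bexE exE conjE)
    fix s assume s: "s \<in> {0..len f}" "chi e1 t1 = chi f s" "\<bar>s - t\<bar> \<le> pl_length w"
    from chi_eq_cases[OF 1(1,3) Cons.prems(2) s(1) s(2)] show ?case
    proof cases
      case same: 1
      have "\<bar>s1 - t\<bar> \<le> pl_length (seg # w)" using s(3) same by (simp add: seg)
      then show ?thesis using 1 same by blast
    next
      case 2
      then show ?thesis using enter[of s "[]"] s by simp
    qed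
  qed (rule enter)
qed

text \<open>
  For fixed end points, a shortened path that is not a single segment has a length in
  \<open>sums_of (len ` E)\<close> up to finitely many possible offsets.  The first alternative covers end points on
  a common edge; there \<open>s'\<close> may differ from \<open>s\<close> when the starting point is a vertex.
\<close>

lemma pl_path_shorten:
  assumes path: "pl_path x w y"
    and e: "e \<in> E" "s \<in> {0..len e}" "x = chi e s"
    and f: "f \<in> E" "t \<in> {0..len f}" "y = chi f t"
  shows "\<exists>w'. pl_path x w' y \<and> pl_length w' \<le> pl_length w \<and>
           ((\<exists>s'\<in>{0..len f}. x = chi f s' \<and> pl_length w' = \<bar>s' - t\<bar>) \<or>
            (\<exists>c\<in>{0, len e}. \<exists>c'\<in>{0, len f}. \<exists>m\<in>sums_of (len ` E).
               pl_length w' = \<bar>s - c\<bar> + m + \<bar>c' - t\<bar>))"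
  using pl_path_last_edge[OF path[unfolded f(3)] f(1,2)]
proof (elim disjE bexE exE conjE)
  fix s' assume s': "s' \<in> {0..len f}" "x = chi f s'" "\<bar>s' - t\<bar> \<le> pl_length w"
  then have "pl_path x [(f, s', t)] y" using f by simp
  then show ?thesis using s' by (intro exI[of _ "[(f, s', t)]"]) auto
next
  fix c' w1 assume c': "c' \<in> {0, len f}" "pl_path x w1 (chi f c')"
    and le: "pl_length w1 + \<bar>c' - t\<bar> \<le> pl_length w"
  have "0 < len e" "0 < len f" using len_pos e f by auto
  have "chi f c' \<in> V" using chi_endpoints[OF f(1)] c' by auto
  from pl_path_to_vertex_shorten[OF c'(2) this e]
  obtain c w2 where c: "c \<in> {0, len e}" "pl_path (chi e c) w2 (chi f c')"
    "pl_length w2 \<in> sums_of (len ` E)" "\<bar>s - c\<bar> + pl_length w2 \<le> pl_length w1"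
    by blast
  let ?w = "(e, s, c) # w2 @ [(f, c', t)]"
  have "pl_path x ?w y"
    using c c' e f \<open>0 < len e\<close> \<open>0 < len f\<close> by (auto simp: pl_path_append)
  moreover have eq: "pl_length ?w = \<bar>s - c\<bar> + pl_length w2 + \<bar>c' - t\<bar>" by simp
  moreover have "pl_length ?w \<le> pl_length w" using le c(4) unfolding eq by linarith
  ultimately show ?thesis using c(1,3) c'(1) by blast
qed

section \<open>The distance to the vertex set\<close>

definition depth :: "'a \<Rightarrow> real" where
  "depth x = (INF v\<in>V. path_dist x v)"

lemma depth_chi:
  assumes e: "e \<in> E" "s \<in> {0..len e}"
  shows "depth (chi e s) = min s (len e - s)"
proof -
  let ?x = "chi e s"
  have top: "?x \<in> topspace X" "V \<subseteq> topspace X"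
    using chi_in_topspace[OF e] cells_cover by auto
  have ends: "chi e 0 \<in> V" "chi e (len e) \<in> V" using chi_endpoints e by auto
  have lower: "min s (len e - s) \<le> path_dist ?x v" if "v \<in> V" for v
  proof (rule path_dist_greatest)
    fix w assume "pl_path ?x w v"
    from pl_path_to_vertex_shorten[OF this that e refl]
    obtain c w' where "c \<in> {0, len e}" "\<bar>s - c\<bar> + pl_length w' \<le> pl_length w" by blast
    then show "min s (len e - s) \<le> pl_length w"
      using pl_length_nonneg[of w'] e by auto
  qed (use that top in auto)
  have bdd: "bdd_below (path_dist ?x ` V)" using lower by (intro bdd_belowI2)
  have "depth ?x \<le> \<bar>s - c\<bar>" if "c \<in> {0, len e}" for c
  proof -
    have "pl_path ?x [(e, s, c)] (chi e c)" using e that len_pos[OF e(1)] by auto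
    then have "path_dist ?x (chi e c) \<le> \<bar>s - c\<bar>" using path_dist_le by fastforce
    moreover have "depth ?x \<le> path_dist ?x (chi e c)"
      unfolding depth_def using bdd ends that by (intro cINF_lower) auto
    ultimately show ?thesis by linarith
  qed
  from this[of 0] this[of "len e"] have "depth ?x \<le> min s (len e - s)" using e by auto
  moreover have "min s (len e - s) \<le> depth ?x"
    unfolding depth_def using ends lower by (intro cINF_greatest) auto
  ultimately show ?thesis by linarith
qed

end

section \<open>Invariants of cocompact actions\<close>

context metric_graph_action
begin

lemma depth_act:
  assumes "x \<in> topspace X" shows "depth (act x g) = depth x"
proof -
  have V: "V \<subseteq> topspace X" using cells_cover by auto
  have "v \<in> (\<lambda>u. act u g) ` V" if "v \<in> V" for v
    by (rule image_eqI[of _ _ "act v (- g)"])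
      (use that V act_vertex act_add act_zero in auto)
  then have "(\<lambda>u. act u g) ` V = V" using act_vertex by auto
  then have "depth (act x g) = (INF v\<in>(\<lambda>u. act u g) ` V. path_dist (act x g) v)"
    by (simp add: depth_def)
  also have "\<dots> = (INF u\<in>V. path_dist (act x g) (act u g))" by (simp add: image_image)
  also have "\<dots> = (INF u\<in>V. path_dist x u)"
    using V assms act_isometric by (intro INF_cong refl) auto
  finally show ?thesis by (simp add: depth_def)
qed

text \<open>
  The length of an edge is twice the largest value of the invariant function \<open>depth\<close> on it.
\<close>

lemma act_edge_len:
  assumes e: "e \<in> E"
  obtains f where "f \<in> E" "len f = len e" "(\<lambda>x. act x g) ` edge e = edge f"
proof -
  obtain f where f: "f \<in> E" "(\<lambda>x. act x g) ` edge e = edge f" using act_edge e by blast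
  have pos: "0 < len e" "0 < len f" using len_pos e f by auto
  have "chi e (len e / 2) \<in> edge e" using pos by (auto simp: edge_def)
  then have "act (chi e (len e / 2)) g \<in> edge f" using f by blast
  then obtain t where t: "t \<in> {0..len f}" "act (chi e (len e / 2)) g = chi f t"
    by (auto simp: edge_def)
  have "depth (chi e (len e / 2)) = depth (chi f t)"
    using depth_act[of "chi e (len e / 2)" g] chi_in_topspace e pos t by simp
  then have "len e \<le> len f" using depth_chi e f t pos by (auto simp: min_def split: if_splits)
  have "chi f (len f / 2) \<in> (\<lambda>x. act x g) ` edge e" using pos f by (auto simp: edge_def)
  then obtain s where s: "s \<in> {0..len e}" "act (chi e s) g = chi f (len f / 2)"
    by (auto simp: edge_def)
  have "depth (chi e s) = depth (chi f (len f / 2))"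
    using depth_act[of "chi e s" g] chi_in_topspace e s by simp
  then have "len f \<le> len e" using depth_chi e f s pos by (auto simp: min_def split: if_splits)
  with \<open>len e \<le> len f\<close> f that show ?thesis by simp
qed

text \<open>
  Since \<open>depth\<close> determines the position on an edge up to reversal, an edge is mapped to its image
  with at worst a pointwise ambiguity between \<open>s\<close> and \<open>len e - s\<close>; midpoints are mapped to
  midpoints.
\<close>

lemma act_chi:
  assumes e: "e \<in> E" "s \<in> {0..len e}"
  obtains f t where "f \<in> E" "len f = len e" "t \<in> {s, len e - s}" "act (chi e s) g = chi f t"
proof -
  obtain f where f: "f \<in> E" "len f = len e" "(\<lambda>x. act x g) ` edge e = edge f"
    using act_edge_len[OF e(1)] .
  have "chi e s \<in> edge e" using e by (auto simp: edge_def)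
  then have "act (chi e s) g \<in> edge f" using f(3) by blast
  then obtain t where t: "t \<in> {0..len f}" "act (chi e s) g = chi f t" by (auto simp: edge_def)
  have "depth (chi e s) = depth (chi f t)"
    using depth_act[of "chi e s" g] chi_in_topspace e t by simp
  then have "min s (len e - s) = min t (len e - t)" using depth_chi e f t by metis
  then have "t \<in> {s, len e - s}" by (auto simp: min_def split: if_splits)
  then show ?thesis using that f t by blast
qed

text \<open>
  For each edge length \<open>l\<close>, remove from \<open>X\<close> the midpoints of the edges of any other length.
  Each edge loses at most one point, so these sets are open in the weak topology.  They are
  invariant, hence descend to an open cover of the compact quotient.  The
  midpoint of an edge of length \<open>l\<close> lies only in the set for \<open>l\<close>, so no proper subfamily is a
  cover and there are only finitely many \<open>l\<close>.
\<close>

lemma finite_edge_lengths: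
  assumes cocompact shows "finite (len ` E)"
proof (cases "E = {}")
  case False
  obtain Q where Q: "quotient_map X Q orbit" "compact_space Q"
    using assms unfolding cocompact_def by blast
  have mid_eq: "e = f" "s = len e / 2"
    if "e \<in> E" "f \<in> E" "s \<in> {0..len e}" "chi e s = chi f (len f / 2)" for e f s
  proof -
    have pos: "0 < len f" using that len_pos by auto
    then have "len f / 2 \<in> {0..len f}" by auto
    from chi_eq_cases[OF that(1,3,2) this that(4)] pos
    have "e = f \<and> s = len f / 2" by cases auto
    then show "e = f" "s = len e / 2" by auto
  qed
  define U where "U l = topspace X - {chi e (len e / 2) | e. e \<in> E \<and> len e \<noteq> l}" for l
  have U_open: "openin X (U l)" for l
  proof (subst weak_topology)
    show "\<forall>e\<in>E. openin (top_of_set {0..len e}) {s \<in> {0..len e}. chi e s \<in> U l}"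
    proof
      fix e assume e: "e \<in> E"
      show "openin (top_of_set {0..len e}) {s \<in> {0..len e}. chi e s \<in> U l}"
      proof (cases "len e = l")
        case True
        then have "{s \<in> {0..len e}. chi e s \<in> U l} = {0..len e}"
          using e chi_in_topspace mid_eq(1) by (fastforce simp: U_def)
        then show ?thesis by simp
      next
        case False
        then have "{s \<in> {0..len e}. chi e s \<in> U l} = {0..len e} \<inter> (- {len e / 2})"
          using e chi_in_topspace mid_eq by (fastforce simp: U_def)
        then show ?thesis by (simp only:) (intro openin_open_Int open_Compl closed_singleton)
      qed
    qed
  qed (auto simp: U_def)
  have U_inv: "y \<in> U l" if y: "act y g \<in> U l" "y \<in> topspace X" for y g l
  proof (rule ccontr)
    assume "y \<notin> U l"
    then obtain e where e: "e \<in> E" "len e \<noteq> l" "y = chi e (len e / 2)"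
      using y by (auto simp: U_def)
    have half: "len e / 2 \<in> {0..len e}" using len_pos[OF e(1)] by auto
    obtain f t where f: "f \<in> E" "len f = len e" "t \<in> {len e / 2, len e - len e / 2}"
      "act y g = chi f t"
      using act_chi[OF e(1) half] e(3) by metis
    then have "t = len f / 2" by auto
    then have "act y g = chi f (len f / 2)" using f(4) by (simp only:)
    then show False using f e y(1) by (auto simp: U_def)
  qed
  have orbit_self: "x \<in> orbit x" if "x \<in> topspace X" for x
    unfolding orbit_def using act_zero[OF that] by (metis rangeI)
  have preimage: "{x \<in> topspace X. orbit x \<in> orbit ` U l} = U l" for l
  proof
    show "{x \<in> topspace X. orbit x \<in> orbit ` U l} \<subseteq> U l"
    proof
      fix x assume "x \<in> {x \<in> topspace X. orbit x \<in> orbit ` U l}"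
      then obtain y where x: "x \<in> topspace X" and y: "y \<in> U l" "orbit x = orbit y" by blast
      then have "y \<in> orbit x" using orbit_self by (auto simp: U_def)
      then obtain g where "y = act x g" by (auto simp: orbit_def)
      then show "x \<in> U l" using U_inv x y by blast
    qed
  qed (auto simp: U_def)
  have img: "orbit ` topspace X = topspace Q" using Q quotient_imp_surjective_map by blast
  have Q_open: "openin Q (orbit ` U l)" for l
  proof -
    have "orbit ` U l \<subseteq> topspace Q" using img by (auto simp: U_def)
    then show ?thesis using Q(1) preimage U_open unfolding quotient_map_def by metis
  qed
  have cover: "topspace Q \<subseteq> \<Union>((\<lambda>l. orbit ` U l) ` len ` E)"
  proof
    fix q assume "q \<in> topspace Q"
    then obtain x where x: "x \<in> topspace X" "q = orbit x" using img by blast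
    have "\<exists>l\<in>len ` E. x \<in> U l"
    proof (cases "\<exists>e\<in>E. x = chi e (len e / 2)")
      case True
      then obtain e where e: "e \<in> E" "x = chi e (len e / 2)" by blast
      have "len e / 2 \<in> {0..len e}" using len_pos[OF e(1)] by auto
      then have "len f = len e" if "f \<in> E" "x = chi f (len f / 2)" for f
        using mid_eq(1)[of e f "len e / 2"] e that by simp
      then have "x \<in> U (len e)" using x by (auto simp: U_def)
      then show ?thesis using e by blast
    next
      case F: False
      then show ?thesis using x \<open>E \<noteq> {}\<close> by (auto simp: U_def)
    qed
    then show "q \<in> \<Union>((\<lambda>l. orbit ` U l) ` len ` E)" using x by blast
  qed
  obtain F where F: "finite F" "F \<subseteq> (\<lambda>l. orbit ` U l) ` len ` E" "topspace Q \<subseteq> \<Union>F"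
    using Q(2) cover Q_open unfolding compact_space_alt by (metis (no_types, lifting) imageE)
  obtain L where L: "finite L" "F = (\<lambda>l. orbit ` U l) ` L"
    using finite_subset_image[OF F(1,2)] by blast
  have "len e \<in> L" if e: "e \<in> E" for e
  proof -
    have "len e / 2 \<in> {0..len e}" using len_pos[OF e] by auto
    then have x: "chi e (len e / 2) \<in> topspace X" using chi_in_topspace e by blast
    then obtain l where l: "l \<in> L" "orbit (chi e (len e / 2)) \<in> orbit ` U l"
      using F(3) L(2) img by blast
    then have "chi e (len e / 2) \<in> U l" using x preimage[of l] by blast
    then show ?thesis using l e by (auto simp: U_def)
  qed
  then have "len ` E \<subseteq> L" by auto
  then show ?thesis using L(1) by (rule finite_subset)
qed simp

text \<open>
  If \<open>p\<close> sits at parameter \<open>s\<close> of the edge \<open>e\<close>, all its translates sit at parameter \<open>s\<close> or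
  \<open>len e - s\<close> of an edge of the same length.  So the initial and the final piece of a path from
  \<open>p\<close> to a translate have one of these two lengths, and if the two points lie on one edge, the
  segment between them has length \<open>0\<close> or \<open>\<bar>len e - 2 * s\<bar>\<close>.
\<close>

lemma based_length_in_finitely_generated:
  assumes cocompact and p: "p \<in> topspace X"
  shows "\<exists>B. finite B \<and> range (based_length p) \<subseteq> sums_of B"
proof (cases "\<exists>e\<in>E. \<exists>s\<in>{0..len e}. p = chi e s")
  \<comment> \<open>A point on no edge admits only the empty path.\<close>
  case False
  have "based_length p g \<in> sums_of {}" for g
  proof -
    obtain w where w: "pl_path p w (act p g)" using pl_path_exists act_closed p by blast
    with False have "w = []" by (cases w) fastforce+
    then have "based_length p g \<le> 0"
      using w path_dist_le[OF w] by (simp add: based_length_def)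
    moreover have "0 \<le> based_length p g"
      unfolding based_length_def
      using p act_closed pl_length_nonneg by (intro path_dist_greatest) auto
    ultimately show ?thesis using sums_of_0 by (metis order_antisym)
  qed
  then show ?thesis by blast
next
  case True
  then obtain e s where e: "e \<in> E" "s \<in> {0..len e}" "p = chi e s" by blast
  define B where "B = len ` E \<union> {0, s, len e - s, \<bar>len e - 2 * s\<bar>}"
  have B: "finite B" "\<And>b. b \<in> B \<Longrightarrow> 0 \<le> b"
    using finite_edge_lengths[OF assms(1)] e len_pos by (auto simp: B_def intro: less_imp_le)
  have "based_length p g \<in> sums_of B" for g
  proof -
    obtain f t where f: "f \<in> E" "len f = len e" "t \<in> {s, len e - s}" "act p g = chi f t"
      using act_chi[OF e(1,2)] e(3) by metis
    have t: "t \<in> {0..len f}" using f e by auto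
    have "\<exists>r\<in>sums_of B \<inter> {pl_length w | w. pl_path p w (act p g)}. r \<le> pl_length w"
      if w: "pl_path p w (act p g)" for w
    proof -
      obtain w' where w': "pl_path p w' (act p g)" "pl_length w' \<le> pl_length w" and
        cases: "(\<exists>s'\<in>{0..len f}. p = chi f s' \<and> pl_length w' = \<bar>s' - t\<bar>) \<or>
            (\<exists>c\<in>{0, len e}. \<exists>c'\<in>{0, len f}. \<exists>m\<in>sums_of (len ` E).
               pl_length w' = \<bar>s - c\<bar> + m + \<bar>c' - t\<bar>)"
        using pl_path_shorten[OF w e f(1) t f(4)] by blast
      from cases have "pl_length w' \<in> sums_of B"
      proof (elim disjE bexE conjE)
        fix s' assume s': "s' \<in> {0..len f}" "p = chi f s'" "pl_length w' = \<bar>s' - t\<bar>"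
        \<comment> \<open>Both sides are \<open>depth p\<close>.\<close>
        have "min s' (len e - s') = min s (len e - s)"
          using depth_chi e f s' by metis
        then have "s' \<in> {s, len e - s}" by (auto simp: min_def split: if_splits)
        then have "\<bar>s' - t\<bar> \<in> B" using f(3) by (auto simp: B_def)
        then show ?thesis using s' sums_of_single by simp
      next
        fix c c' m assume c: "c \<in> {0, len e}" "c' \<in> {0, len f}" "m \<in> sums_of (len ` E)"
          "pl_length w' = \<bar>s - c\<bar> + m + \<bar>c' - t\<bar>"
        have "\<bar>s - c\<bar> \<in> B" "\<bar>c' - t\<bar> \<in> B" using c(1,2) e f by (auto simp: B_def)
        moreover have "m \<in> sums_of B"
          using c(3) sums_of_mono[of "len ` E" B] by (auto simp: B_def)
        ultimately show ?thesis unfolding c(4) by (simp add: sums_of_add sums_of_single)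
      qed
      then show ?thesis using w' by blast
    qed
    moreover have "{pl_length w | w. pl_path p w (act p g)} \<noteq> {}"
      using pl_path_exists act_closed p by blast
    ultimately show ?thesis
      unfolding based_length_def path_dist_def
      using finite_sums_of_bounded[OF B] by (intro Inf_in_locally_finite) auto
  qed
  then show ?thesis using B(1) by blast
qed

end

section \<open>Unbounded denominators of the perturbed absolute value\<close>

lemma l_half_not_in_finitely_generated:
  assumes "finite B" shows "\<not> range (l_eps (1/2)) \<subseteq> sums_of B"
proof
  assume sub: "range (l_eps (1/2)) \<subseteq> sums_of B"
  obtain N :: int where N: "N > 0" "\<And>q. of_rat q \<in> sums_of B \<Longrightarrow> of_int N * q \<in> \<int>"
    using rationals_in_sums_of_common_denominator[OF assms] by auto
  \<comment> \<open>Any \<open>n\<close> with \<open>N < 2 ^ n\<close> makes \<open>N / 2 ^ n\<close> a non-integer.\<close>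
  define n where "n = Suc (nat N)"
  have "n > 0" by (simp add: n_def)
  then have "l_eps (1/2) (int n) = of_rat (of_nat n + (1 / 2) ^ n)"
    by (simp add: l_eps_def of_rat_add of_rat_divide of_rat_power)
  then have "of_rat (of_nat n + (1 / 2) ^ n) \<in> sums_of B" using sub by (metis rangeI subsetD)
  then have "of_int N * (of_nat n + (1 / 2) ^ n) \<in> (\<int> :: rat set)" by (rule N(2))
  then have "of_int N * (of_nat n + (1 / 2) ^ n) - of_int N * of_nat n \<in> (\<int> :: rat set)"
    by (rule Ints_diff) (intro Ints_mult Ints_of_int Ints_of_nat)
  moreover have "of_int N * (of_nat n + (1 / 2) ^ n) - of_int N * of_nat n = (of_int N / 2 ^ n :: rat)"
    by (simp add: distrib_left power_one_over)
  ultimately have "of_int N / 2 ^ n \<in> (\<int> :: rat set)" by (simp only:)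
  then obtain k where "of_int N / 2 ^ n = (of_int k :: rat)" by (elim Ints_cases)
  then have "of_int N = (of_int (k * 2 ^ n) :: rat)" by (simp add: field_simps)
  then have k: "N = k * 2 ^ n" by (simp only: of_int_eq_iff)
  then have "k > 0" using N(1) by (simp add: zero_less_mult_iff)
  have "n < 2 ^ n" by (rule less_exp)
  then have "int n < 2 ^ n" by (metis of_nat_less_iff of_nat_numeral of_nat_power)
  also have "2 ^ n \<le> k * 2 ^ n" using \<open>k > 0\<close> by simp
  finally have "int n < N" by (simp only: k)
  moreover have "N \<le> int n" by (simp add: n_def)
  ultimately show False by linarith
qed

theorem proposition3p4:
  shows "(\<forall>\<epsilon>. 0 \<le> \<epsilon> \<and> \<epsilon> < 1 \<longrightarrow> length_function (l_eps \<epsilon>) \<and> hyperbolic (l_eps \<epsilon>)) \<and>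
    (\<forall>(X :: 'a topology) V (E :: 'e set) len chi (act :: 'a \<Rightarrow> int \<Rightarrow> 'a) p.
        metric_graph_action X V E len chi act \<and>
        metric_graph_action.cocompact X act \<and>
        p \<in> topspace X \<longrightarrow>
        l_eps (1/2) \<noteq> metric_graph_action.based_length E len chi act p)"
proof (intro conjI allI impI)
  fix \<epsilon> :: real assume "0 \<le> \<epsilon> \<and> \<epsilon> < 1"
  then show "length_function (l_eps \<epsilon>)" "hyperbolic (l_eps \<epsilon>)"
    by (simp_all add: length_function_l_eps hyperbolic_l_eps)
next
  fix X :: "'a topology" and V and E :: "'e set" and len chi
    and act :: "'a \<Rightarrow> int \<Rightarrow> 'a" and p
  assume A: "metric_graph_action X V E len chi act \<and>
    metric_graph_action.cocompact X act \<and> p \<in> topspace X"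
  interpret metric_graph_action X V E len chi act using A by blast
  show "l_eps (1/2) \<noteq> based_length p"
    using based_length_in_finitely_generated l_half_not_in_finitely_generated A by metis
qed

end
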